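(* Let $2\le d\le n$ be integers. If $A=(A_0,\dots,A_n)$ is a feasible solution to the $(n,d)$ Delsarte linear program and has support $S$, then its punctured quasicode $A^P=(A^P_0,\dots,A^P_{n-1})$ is a feasible solution to the $(n-1,d-1)$ Delsarte linear program with support $S'\subseteq (S\cup(S-1))\setminus\{n\}$.
   Context: $[a]=\{1,\dots,a\}$ (empty if $a\le 0$). $\binom{a}{b}=0$ unless $0\le b\le a$. For a block length $m$ and $0\le i,j\le m$, the Krawtchouk polynomial is $K_j(i;m)=\sum_{k=0}^j(-1)^k\binom{i}{k}\binom{m-i}{j-k}$. For integers $1\le d\le m$, the $(m,d)$ Delsarte linear program, in real variables $A=(A_0,\dots,A_m)$, is: maximize $\sum_{i=0}^m A_i$ subject to $\sum_{i=0}^m A_iK_j(i;m)\ge 0$ for all $j\in[m]$; $A_i=0$ for all $i\in[d-1]$; $A_0=1$; $A_i\ge 0$ for all $i\in[m]$. A feasible solution is a vector satisfying all of these constraints; it is also called a quasicode. The support of $A=(A_0,\dots,A_m)$ is $\{i>0 : A_i>0\}$. For a set $S$ of integers, $S-1=\{i-1: i\in S\}$. The Krawtchouk decomposition of $A=(A_0,\dots,A_m)$ (block length $m$) is the vector $b=(b_0,\dots,b_m)$ with $b_j=\frac{1}{\binom{m}{j}}\sum_{i=0}^m A_iK_j(i;m)$; equivalently $A_i=\binom{m}{i}\left(\sum_{j=0}^m b_jK_j(i;m)\right)/2^m$ for all $0\le i\le m$. Puncturing: if $A=(A_0,\dots,A_n)$ has Krawtchouk decomposition $b=(b_0,\dots,b_n)$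 (block length $n$), its punctured quasicode $A^P=(A_0^P,\dots,A_{n-1}^P)$ is the vector whose Krawtchouk decomposition with block length $n-1$ is the truncation $(b_0,\dots,b_{n-1})$, i.e. $A_i^P=\binom{n-1}{i}\left(\sum_{j=0}^{n-1}b_jK_j(i;n-1)\right)/2^{n-1}$ for $0\le i\le n-1$. *)

theory Defs
  imports Complex_Main
begin

text \<open>
  A vector with components indexed by 0, ..., m is represented by a function
  of type \<^typ>\<open>nat \<Rightarrow> real\<close> together with its block length m;
  only the values at indices at most m are ever consulted.
\<close>

text \<open>
  Used only for \<open>i \<le> m\<close>, so that no natural number subtraction is truncated.
  The library binomial coefficient already vanishes when the lower index exceeds
  the upper one.
\<close>

definition krawtchouk :: "nat \<Rightarrow> nat \<Rightarrow> nat \<Rightarrow> real" where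
  "krawtchouk m j i =
     (\<Sum>k=0..j. (-1) ^ k * real (i choose k) * real ((m - i) choose (j - k)))"

definition delsarte_feasible :: "nat \<Rightarrow> nat \<Rightarrow> (nat \<Rightarrow> real) \<Rightarrow> bool" where
  "delsarte_feasible m d A \<longleftrightarrow>
     (\<forall>j\<in>{1..m}. (\<Sum>i=0..m. A i * krawtchouk m j i) \<ge> 0) \<and>
     (\<forall>i\<in>{1..d - 1}. A i = 0) \<and>
     A 0 = 1 \<and>
     (\<forall>i\<in>{1..m}. A i \<ge> 0)"

definition qc_support :: "nat \<Rightarrow> (nat \<Rightarrow> real) \<Rightarrow> nat set" where
  "qc_support m A = {i. 0 < i \<and> i \<le> m \<and> A i > 0}"

definition krawtchouk_decomp :: "nat \<Rightarrow> (nat \<Rightarrow> real) \<Rightarrow> nat \<Rightarrow> real" where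
  "krawtchouk_decomp m A j = (1 / real (m choose j)) * (\<Sum>i=0..m. A i * krawtchouk m j i)"

text \<open>
  The vector of block length m whose Krawtchouk decomposition is
  \<open>(b 0, ..., b m)\<close>; values of \<open>b\<close> beyond m are ignored.
\<close>

definition from_krawtchouk_decomp :: "nat \<Rightarrow> (nat \<Rightarrow> real) \<Rightarrow> nat \<Rightarrow> real" where
  "from_krawtchouk_decomp m b i =
     real (m choose i) * (\<Sum>j=0..m. b j * krawtchouk m j i) / 2 ^ m"

text \<open>
  The truncation of the decomposition to \<open>(b 0, ..., b (n - 1))\<close> is implicit in
  the block length \<open>n - 1\<close> of the outer operation.
\<close>

definition punctured :: "nat \<Rightarrow> (nat \<Rightarrow> real) \<Rightarrow> nat \<Rightarrow> real" where
  "punctured n A = from_krawtchouk_decomp (n - 1) (krawtchouk_decomp n A)"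

end

theory Submission
  imports Defs
begin

text \<open>
  Puncturing is defined through the Krawtchouk decomposition, but it is the familiar averaging
  operation on weight distributions: deleting a uniformly random coordinate leaves a word of
  weight \<open>i\<close> at weight \<open>i\<close> with probability \<open>(n - i) / n\<close> and takes it to weight \<open>i - 1\<close> with
  probability \<open>i / n\<close>, so one expects
  \[ A^P_i = \frac{(n - i) A_i + (i + 1) A_{i+1}}{n}. \]
  Once this formula is known (lemma \<open>punctured_eq_averaged\<close>), non-negativity, \<open>A\<^sup>P\<^sub>0 = 1\<close>, the vanishing
  below \<open>d - 1\<close> and the description of the support can be read off, because the coefficients are
  non-negative and \<open>A\<^sub>1 = 0\<close>.

  The formula rests on two facts. First, the averaged vector has the same Krawtchouk transform
  as \<open>A\<close>, up to the factor \<open>(n - j) / n\<close>. This follows from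
  \[ (n - i) K_j(i; n-1) + i K_j(i-1; n-1) = (n - j) K_j(i; n), \]
  which already holds term by term. The factor is exactly the ratio of the
  binomial coefficients by which the two transforms are normalised, so the decompositions agree
  in the indices below \<open>n\<close>; and since it is non-negative, the Delsarte inequalities carry over as
  well. Second, a vector is determined by its decomposition: the Krawtchouk matrix squares
  to \<open>2^m\<close> times the identity, as the generating function shows.
\<close>

section \<open>Krawtchouk polynomials and the inversion formula\<close>

text \<open>
  Both sides expand into the same multinomial coefficients: with \<open>k\<close> the size of the
  intersection, \<open>(m choose i) (i choose k) (m - i choose j - k)\<close> counts pairs of an
  \<open>i\<close>-subset and a \<open>j\<close>-subset of an \<open>m\<close>-set.
\<close>
lemma krawtchouk_symmetry:
  assumes "i \<le> m" "j \<le> m"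
  shows "real (m choose i) * krawtchouk m j i = real (m choose j) * krawtchouk m i j"
proof -
  have le: "(m choose i) * (i choose k) * ((m - i) choose (j - k)) =
            (m choose j) * (j choose k) * ((m - j) choose (i - k))"
    if "i \<le> m" "j \<le> m" "k \<le> i" "k \<le> j" for i j k
  proof (cases "i + j \<le> m + k")
    case True
    have eq: "m - i - (j - k) = m - j - (i - k)" using that by simp
    have "real ((m choose i) * (i choose k) * ((m - i) choose (j - k))) =
          real ((m choose j) * (j choose k) * ((m - j) choose (i - k)))"
      using that True by (simp add: binomial_fact eq add.commute)
    then show ?thesis by (simp only: of_nat_eq_iff)
  next
    case False
    then show ?thesis using that by (simp add: binomial_eq_0)
  qed
  have trunc: "krawtchouk m b a =
      (\<Sum>k=0..min a b. (-1) ^ k * real (a choose k) * real ((m - a) choose (b - k)))" for a b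
    unfolding krawtchouk_def by (rule sum.mono_neutral_right) (auto simp: binomial_eq_0)
  have "real (m choose i) * krawtchouk m j i =
      (\<Sum>k=0..min i j. (-1) ^ k * real ((m choose i) * (i choose k) * ((m - i) choose (j - k))))"
    by (simp add: trunc sum_distrib_left mult_ac)
  also have "\<dots> =
      (\<Sum>k=0..min i j. (-1) ^ k * real ((m choose j) * (j choose k) * ((m - j) choose (i - k))))"
    using le[OF assms] by (intro sum.cong) auto
  also have "\<dots> = real (m choose j) * krawtchouk m i j"
    by (simp add: trunc sum_distrib_left mult_ac min.commute)
  finally show ?thesis .
qed

text \<open>
  The homogeneous form in \<open>u\<close> and \<open>v\<close> is what lets the identity be applied twice: substituting
  \<open>u = 1 - z\<close>, \<open>v = 1 + z\<close> turns \<open>v - u\<close> and \<open>v + u\<close> into the monomials \<open>2 z\<close> and \<open>2\<close>.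
\<close>
lemma krawtchouk_generating_function:
  fixes u v :: real
  assumes "i \<le> m"
  shows "(\<Sum>j\<le>m. krawtchouk m j i * u ^ j * v ^ (m - j)) = (v - u) ^ i * (v + u) ^ (m - i)"
proof -
  define a where "a k = real (i choose k) * (-1) ^ k * v ^ (i - k)" for k
  define b where "b k = real ((m - i) choose k) * v ^ (m - i - k)" for k
  have "(v - u) ^ i = (\<Sum>k\<le>i. a k * u ^ k)"
    using binomial_ring[of "-u" v i]
    by (simp add: a_def power_minus[of u] mult_ac)
  moreover have "(v + u) ^ (m - i) = (\<Sum>k\<le>m - i. b k * u ^ k)"
    using binomial_ring[of u v "m - i"] by (simp add: b_def add.commute mult_ac)
  ultimately have "(v - u) ^ i * (v + u) ^ (m - i) =
      (\<Sum>r\<le>i + (m - i). (\<Sum>k\<le>r. a k * b (r - k)) * u ^ r)"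
    by (simp only:) (rule polynomial_product, auto simp: a_def b_def binomial_eq_0)
  also have "\<dots> = (\<Sum>j\<le>m. krawtchouk m j i * u ^ j * v ^ (m - j))"
  proof (intro sum.cong)
    fix r assume "r \<in> {..m}"
    have "a k * b (r - k) =
        (-1) ^ k * real (i choose k) * real ((m - i) choose (r - k)) * v ^ (m - r)"
      if "k \<le> r" for k
    proof (cases "k \<le> i \<and> r - k \<le> m - i")
      case True
      then have "(i - k) + (m - i - (r - k)) = m - r" using that assms by linarith
      then have "v ^ (i - k) * v ^ (m - i - (r - k)) = v ^ (m - r)"
        by (metis power_add)
      then show ?thesis by (simp add: a_def b_def)
    next
      case False
      then show ?thesis by (auto simp: a_def b_def binomial_eq_0)
    qed
    then have "(\<Sum>k\<le>r. a k * b (r - k)) = krawtchouk m r i * v ^ (m - r)"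
      by (simp add: krawtchouk_def sum_distrib_right atLeast0AtMost)
    then show "(\<Sum>k\<le>r. a k * b (r - k)) * u ^ r = krawtchouk m r i * u ^ r * v ^ (m - r)"
      by simp
  qed (use assms in simp)
  finally show ?thesis by simp
qed

text \<open>
  The generating function of the left-hand side in the index \<open>i\<close> is
  \<open>\<Sum>j. (1 - z)^j (1 + z)^(m - j) K\<^sub>j(l)\<close>, which collapses to \<open>2^m z^l\<close> by a second use of the
  generating function identity; comparing coefficients of \<open>z\<close> finishes the proof.
\<close>
lemma krawtchouk_matrix_square:
  assumes "l \<le> m" "i \<le> m"
  shows "(\<Sum>j\<le>m. krawtchouk m j l * krawtchouk m i j) = (if i = l then 2 ^ m else 0)"
proof -
  have "(\<Sum>i\<le>m. (\<Sum>j\<le>m. krawtchouk m j l * krawtchouk m i j) * z ^ i) =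
        (\<Sum>i\<le>m. (if i = l then 2 ^ m else 0) * z ^ i)" for z :: real
  proof -
    have "(\<Sum>i\<le>m. (\<Sum>j\<le>m. krawtchouk m j l * krawtchouk m i j) * z ^ i) =
          (\<Sum>j\<le>m. krawtchouk m j l * (\<Sum>i\<le>m. krawtchouk m i j * z ^ i))"
      unfolding sum_distrib_right sum_distrib_left mult.assoc by (rule sum.swap)
    also have "\<dots> = (\<Sum>j\<le>m. krawtchouk m j l * (1 - z) ^ j * (1 + z) ^ (m - j))"
    proof (intro sum.cong refl)
      fix j assume "j \<in> {..m}"
      then show "krawtchouk m j l * (\<Sum>i\<le>m. krawtchouk m i j * z ^ i) =
                 krawtchouk m j l * (1 - z) ^ j * (1 + z) ^ (m - j)"
        using krawtchouk_generating_function[of j m z 1] by simp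
    qed
    also have "\<dots> = (2 * z) ^ l * 2 ^ (m - l)"
      using krawtchouk_generating_function[OF assms(1), of "1 - z" "1 + z"] by simp
    also have "\<dots> = 2 ^ m * z ^ l"
      using assms(1) by (simp add: power_mult_distrib flip: power_add)
    also have "\<dots> = (\<Sum>i\<le>m. if i = l then 2 ^ m * z ^ i else 0)"
      using assms(1) by simp
    also have "\<dots> = (\<Sum>i\<le>m. (if i = l then 2 ^ m else 0) * z ^ i)"
      by (intro sum.cong) auto
    finally show ?thesis .
  qed
  then have "\<forall>i\<le>m. (\<Sum>j\<le>m. krawtchouk m j l * krawtchouk m i j) = (if i = l then 2 ^ m else 0)"
    by (intro polyfun_eq_coeffs[THEN iffD1] allI)
  with assms(2) show ?thesis by blast
qed

text \<open>
  The symmetry relation moves the binomial coefficient \<open>m choose i\<close> of the inverse transform onto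
  the index \<open>j\<close>, where it cancels the normalisation of the decomposition; what is left is the
  square of the Krawtchouk matrix.
\<close>
lemma from_krawtchouk_decomp_krawtchouk_decomp:
  assumes "i \<le> m"
  shows "from_krawtchouk_decomp m (krawtchouk_decomp m B) i = B i"
proof -
  have "real (m choose i) * (\<Sum>j\<le>m. krawtchouk_decomp m B j * krawtchouk m j i) =
        (\<Sum>j\<le>m. \<Sum>l\<le>m. B l * (krawtchouk m j l * krawtchouk m i j))"
    unfolding sum_distrib_left
  proof (intro sum.cong refl)
    fix j assume "j \<in> {..m}"
    then have j: "j \<le> m" by simp
    then have "real (m choose j) \<noteq> 0" by simp
    then have "real (m choose i) * (krawtchouk_decomp m B j * krawtchouk m j i) =
        (\<Sum>l=0..m. B l * krawtchouk m j l) * krawtchouk m i j"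
      using krawtchouk_symmetry[OF assms j]
      by (simp add: krawtchouk_decomp_def field_simps)
    then show "real (m choose i) * (krawtchouk_decomp m B j * krawtchouk m j i) =
        (\<Sum>l\<le>m. B l * (krawtchouk m j l * krawtchouk m i j))"
      by (simp add: sum_distrib_right atLeast0AtMost mult.assoc)
  qed
  also have "\<dots> = (\<Sum>l\<le>m. B l * (\<Sum>j\<le>m. krawtchouk m j l * krawtchouk m i j))"
    unfolding sum_distrib_left by (rule sum.swap)
  also have "\<dots> = (\<Sum>l\<le>m. if l = i then B l * 2 ^ m else 0)"
    by (intro sum.cong) (auto simp: krawtchouk_matrix_square assms)
  also have "\<dots> = B i * 2 ^ m" using assms by simp
  finally show ?thesis
    by (simp add: from_krawtchouk_decomp_def atLeast0AtMost)
qed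

section \<open>Puncturing as averaging\<close>

text \<open>
  The effect on the weight distribution of deleting a uniformly random one of \<open>Suc m\<close>
  coordinates.
\<close>
definition averaged :: "nat \<Rightarrow> (nat \<Rightarrow> real) \<Rightarrow> nat \<Rightarrow> real" where
  "averaged m A i = (real (Suc m - i) * A i + real (Suc i) * A (Suc i)) / real (Suc m)"

text \<open>
  Absorbing the factors \<open>Suc m - i\<close> and \<open>i\<close> into the binomial coefficients multiplies the
  \<open>k\<close>-th summand of \<open>K\<^sub>j(i; Suc m)\<close> by \<open>Suc m - i - (j - k)\<close> and \<open>i - k\<close>, and the sum of these is
  \<open>Suc m - j\<close> for every \<open>k\<close>. At \<open>i = 0\<close> (where \<open>i - 1\<close> is truncated)
  and at \<open>i = Suc m\<close> (where \<open>K\<^sub>j(i; m)\<close> is meaningless) the term in question has coefficient zero.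
\<close>
lemma krawtchouk_average:
  assumes "i \<le> Suc m"
  shows "real (Suc m - i) * krawtchouk m j i + real i * krawtchouk m j (i - 1) =
         (real (Suc m) - real j) * krawtchouk (Suc m) j i"
proof -
  have absorb: "real a * real ((a - 1) choose b) = (real a - real b) * real (a choose b)" for a b
  proof (cases "b \<le> a")
    case True
    have "real ((a - b) * (a choose b)) = real (a * ((a - 1) choose b))"
      by (simp only: binomial_absorb_comp)
    then show ?thesis using True by (simp add: of_nat_diff)
  qed (auto simp: binomial_eq_0)
  have "real (Suc m - i) * krawtchouk m j i + real i * krawtchouk m j (i - 1) =
     (\<Sum>k=0..j. (-1) ^ k * real (i choose k) *
                 (real (Suc m - i) * real ((Suc m - i - 1) choose (j - k))) +
                (-1) ^ k * (real i * real ((i - 1) choose k)) *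
                 real ((Suc m - i) choose (j - k)))"
  proof (cases "i = 0")
    case False
    then have "m - (i - 1) = Suc m - i" by simp
    then show ?thesis
      by (simp add: krawtchouk_def sum_distrib_left sum.distrib mult_ac)
  qed (simp add: krawtchouk_def sum_distrib_left mult_ac)
  also have "\<dots> = (\<Sum>k=0..j. (real (Suc m) - real j) *
      ((-1) ^ k * real (i choose k) * real ((Suc m - i) choose (j - k))))"
    unfolding absorb using assms
    by (intro sum.cong) (auto simp: of_nat_diff algebra_simps)
  finally show ?thesis
    by (simp only: krawtchouk_def sum_distrib_left)
qed

text \<open>
  Averaging is adjoint to the operation on Krawtchouk polynomials in the previous identity:
  collecting the terms with a fixed entry of \<open>A\<close> produces its left-hand side.
\<close>
lemma krawtchouk_transform_averaged:
  "(\<Sum>i\<le>m. averaged m A i * krawtchouk m j i) =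
   (real (Suc m) - real j) / real (Suc m) * (\<Sum>i\<le>Suc m. A i * krawtchouk (Suc m) j i)"
proof -
  have "real (Suc m) * (\<Sum>i\<le>m. averaged m A i * krawtchouk m j i) =
      (\<Sum>i\<le>m. real (Suc m - i) * A i * krawtchouk m j i) +
      (\<Sum>i\<le>m. real (Suc i) * A (Suc i) * krawtchouk m j i)"
    unfolding sum_distrib_left sum.distrib[symmetric]
    by (intro sum.cong) (simp_all add: averaged_def field_simps del: of_nat_Suc)
  \<comment> \<open>Both ranges extend to \<open>{..Suc m}\<close>, as the factors \<open>Suc m - i\<close> and \<open>i\<close> vanish at the ends.\<close>
  also have "(\<Sum>i\<le>m. real (Suc m - i) * A i * krawtchouk m j i) =
      (\<Sum>i\<le>Suc m. real (Suc m - i) * A i * krawtchouk m j i)"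
    by simp
  also have "(\<Sum>i\<le>m. real (Suc i) * A (Suc i) * krawtchouk m j i) =
      (\<Sum>i\<le>Suc m. real i * A i * krawtchouk m j (i - 1))"
    by (subst sum.atMost_Suc_shift) simp
  also have "(\<Sum>i\<le>Suc m. real (Suc m - i) * A i * krawtchouk m j i) +
      (\<Sum>i\<le>Suc m. real i * A i * krawtchouk m j (i - 1)) =
      (\<Sum>i\<le>Suc m. A i *
        (real (Suc m - i) * krawtchouk m j i + real i * krawtchouk m j (i - 1)))"
    unfolding sum.distrib[symmetric]
    by (intro sum.cong) (simp_all add: distrib_left mult_ac)
  also have "\<dots> = (\<Sum>i\<le>Suc m. A i * ((real (Suc m) - real j) * krawtchouk (Suc m) j i))"
    by (intro sum.cong) (simp_all only: krawtchouk_average atMost_iff)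
  also have "\<dots> = (real (Suc m) - real j) * (\<Sum>i\<le>Suc m. A i * krawtchouk (Suc m) j i)"
    unfolding sum_distrib_left by (intro sum.cong) (simp_all only: mult_ac)
  finally show ?thesis
    by (simp add: nonzero_eq_divide_eq mult.commute del: of_nat_Suc sum.atMost_Suc)
qed

lemma krawtchouk_decomp_averaged:
  assumes "j \<le> m"
  shows "krawtchouk_decomp m (averaged m A) j = krawtchouk_decomp (Suc m) A j"
proof -
  have "(Suc m - j) * (Suc m choose j) = Suc m * (m choose j)"
    using binomial_absorb_comp[of "Suc m" j] by simp
  then have "real (Suc m - j) * real (Suc m choose j) = real (Suc m) * real (m choose j)"
    by (metis of_nat_mult)
  then have choose: "(real (Suc m) - real j) * real (Suc m choose j) =
      real (Suc m) * real (m choose j)"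
    using assms by (simp add: of_nat_diff)
  have "real (m choose j) \<noteq> 0" "real (Suc m choose j) \<noteq> 0" "real (Suc m) \<noteq> 0"
    using assms by (simp_all del: binomial_Suc_Suc add: not_less)
  with choose have "1 / real (m choose j) * ((real (Suc m) - real j) / real (Suc m)) =
      1 / real (Suc m choose j)"
    by (simp only: divide_simps) simp
  then show ?thesis
    unfolding krawtchouk_decomp_def atLeast0AtMost krawtchouk_transform_averaged
      mult.assoc[symmetric]
    by simp
qed

lemma punctured_eq_averaged:
  assumes "i \<le> m"
  shows "punctured (Suc m) A i = averaged m A i"
proof -
  have "punctured (Suc m) A i = from_krawtchouk_decomp m (krawtchouk_decomp m (averaged m A)) i"
    by (simp add: punctured_def from_krawtchouk_decomp_def krawtchouk_decomp_averaged)
  then show ?thesis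
    by (simp add: from_krawtchouk_decomp_krawtchouk_decomp assms)
qed

section \<open>Feasibility and support of the punctured quasicode\<close>

theorem proposition5p3:
  fixes n d :: nat and A :: "nat \<Rightarrow> real" and S :: "nat set"
  assumes "2 \<le> d" and "d \<le> n"
    and "delsarte_feasible n d A"
    and "S = qc_support n A"
  shows "delsarte_feasible (n - 1) (d - 1) (punctured n A) \<and>
         qc_support (n - 1) (punctured n A) \<subseteq> (S \<union> (\<lambda>i. i - 1) ` S) - {n}"
proof -
  obtain m where n: "n = Suc m"
    using assms(1,2) by (cases n) auto
  have dual: "(\<Sum>i\<le>Suc m. A i * krawtchouk (Suc m) j i) \<ge> 0" if "1 \<le> j" "j \<le> Suc m" for j
    using assms(3) that by (simp add: delsarte_feasible_def n atLeast0AtMost)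
  have vanish: "A i = 0" if "1 \<le> i" "i \<le> d - 1" for i
    using assms(3) that by (auto simp: delsarte_feasible_def)
  have A0: "A 0 = 1" using assms(3) by (simp add: delsarte_feasible_def)
  have nonneg: "A i \<ge> 0" if "i \<le> Suc m" for i
    using assms(3) that A0 by (cases "i = 0") (auto simp: delsarte_feasible_def n)
  have eq: "punctured n A i = averaged m A i" if "i \<le> m" for i
    using that by (simp add: n punctured_eq_averaged)

  have "(\<Sum>i=0..m. punctured n A i * krawtchouk m j i) \<ge> 0" if "j \<in> {1..m}" for j
  proof -
    have "(\<Sum>i=0..m. punctured n A i * krawtchouk m j i) =
          (\<Sum>i\<le>m. averaged m A i * krawtchouk m j i)"
      by (intro sum.cong) (auto simp: eq)
    also have "\<dots> \<ge> 0"
      unfolding krawtchouk_transform_averaged using that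
      by (intro mult_nonneg_nonneg divide_nonneg_nonneg dual) auto
    finally show ?thesis .
  qed
  moreover have "punctured n A i = 0" if "i \<in> {1..d - 1 - 1}" for i
  proof -
    have "i \<le> m" "A i = 0" "A (Suc i) = 0"
      using that assms(1,2) by (auto simp: n intro!: vanish)
    then show ?thesis by (simp add: eq averaged_def)
  qed
  moreover have "punctured n A 0 = 1"
    using assms(1) A0 vanish[of 1] by (simp add: eq averaged_def)
  moreover have "punctured n A i \<ge> 0" if "i \<in> {1..m}" for i
    using that nonneg[of i] nonneg[of "Suc i"] by (simp add: eq averaged_def)
  ultimately have feasible: "delsarte_feasible (n - 1) (d - 1) (punctured n A)"
    by (simp add: delsarte_feasible_def n)

  have "i \<in> (S \<union> (\<lambda>i. i - 1) ` S) - {n}" if "i \<in> qc_support (n - 1) (punctured n A)" for i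
  proof -
    have i: "0 < i" "i \<le> m" "averaged m A i > 0"
      using that by (auto simp: qc_support_def n eq[unfolded n])
    have "A i > 0 \<or> A (Suc i) > 0"
    proof (rule ccontr)
      assume "\<not> (A i > 0 \<or> A (Suc i) > 0)"
      then have "A i = 0" "A (Suc i) = 0"
        using nonneg[of i] nonneg[of "Suc i"] i(2) by auto
      then show False using i(3) by (simp add: averaged_def)
    qed
    then have "i \<in> S \<or> Suc i \<in> S"
      using i(1,2) by (auto simp: assms(4) qc_support_def n)
    then show ?thesis
      using i(2) by (force simp: n)
  qed
  with feasible show ?thesis by blast
qed

end
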